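(* For all positive integers $a,b$, the complete bipartite graph $K_{a,b}$ satisfies $$M(K_{a,b})=a+b+\binom{a}{2}+\binom{b}{2}.$$
   Context: Graphs are finite, simple and undirected. $K_{a,b}$ is the complete bipartite graph with vertex classes $A=\{1,\dots,a\}$ and $B=\{a+1,\dots,a+b\}$ and edge set $\{\{\alpha,\beta\} : \alpha\in A,\beta\in B\}$. For a graph $\mathcal{G}$ with $n$ vertices and adjacency matrix $A$, viewed over $\mathbb{F}_2$, let $C(\mathcal{G})\subseteq\mathbb{F}_2^{2n}$ be the binary linear code generated by the rows of $[I_n|A]$, where $I_n$ is the $n\times n$ identity matrix. The support of a vector is the set of positions of its nonzero entries. A nonzero codeword $c$ of a binary linear code $C$ is minimal if there is no nonzero codeword $c'\in C$ with $\operatorname{supp}(c')\subsetneq\operatorname{supp}(c)$. $M(\mathcal{G})$ denotes the number of minimal codewords of $C(\mathcal{G})$; it does not depend on the labeling of the vertices. *)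

theory Defs
  imports
    "HOL-Library.Z2"
    "Jordan_Normal_Form.VS_Connect"
    "Graph_Theory.Kuratowski"
begin

text \<open>As in \<^theory>\<open>Graph_Theory.Kuratowski\<close>, a finite simple undirected graph is a finite
  symmetric irreflexive digraph: an edge \<open>{u, v}\<close> is the pair of arcs \<open>(u, v)\<close>, \<open>(v, u)\<close>.\<close>

definition complete_bipartite :: "nat \<Rightarrow> nat \<Rightarrow> nat pair_pre_digraph" where
  "complete_bipartite a b =
    \<lparr>pverts = {1..a} \<union> {a+1..a+b},
     parcs = {1..a} \<times> {a+1..a+b} \<union> {a+1..a+b} \<times> {1..a}\<rparr>"

lemma complete_bipartite_digraph_complete_bipartite:
  "complete_bipartite_digraph a b (with_proj (complete_bipartite a b))"
  unfolding complete_bipartite_digraph_pair_def complete_bipartite_def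
  by (intro conjI exI[of _ "{1..a}"] exI[of _ "{a+1..a+b}"]) auto

lemma pair_graph_complete_bipartite: "pair_graph (complete_bipartite a b)"
  by (rule pair_graphI_complete_bipartite) (rule complete_bipartite_digraph_complete_bipartite)

text \<open>Rows and columns follow the vertices in increasing order.\<close>

definition adjacency_matrix :: "'v::linorder pair_pre_digraph \<Rightarrow> bit mat" where
  "adjacency_matrix G =
    (let n = card (pverts G); vs = sorted_list_of_set (pverts G)
     in mat n n (\<lambda>(i, j). if (vs ! i, vs ! j) \<in> parcs G then 1 else 0))"

text \<open>The matrix \<open>[I | A]\<close>; the lower two blocks have no rows.\<close>

definition generator_matrix :: "'v::linorder pair_pre_digraph \<Rightarrow> bit mat" where
  "generator_matrix G =
    (let n = card (pverts G)
     in four_block_mat (1\<^sub>m n) (adjacency_matrix G) (0\<^sub>m 0 n) (0\<^sub>m 0 n))"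

definition graph_code :: "'v::linorder pair_pre_digraph \<Rightarrow> bit vec set" where
  "graph_code G = vec_space.row_space (2 * card (pverts G)) (generator_matrix G)"

definition supp_vec :: "'a::zero vec \<Rightarrow> nat set" where
  "supp_vec v = {i. i < dim_vec v \<and> v $ i \<noteq> 0}"

definition minimal_codeword :: "'a::zero vec set \<Rightarrow> 'a vec \<Rightarrow> bool" where
  "minimal_codeword C c \<longleftrightarrow>
     c \<in> C \<and> c \<noteq> 0\<^sub>v (dim_vec c) \<and>
     \<not> (\<exists>c'\<in>C. c' \<noteq> 0\<^sub>v (dim_vec c') \<and> supp_vec c' \<subset> supp_vec c)"

definition num_minimal_codewords :: "'v::linorder pair_pre_digraph \<Rightarrow> nat" where
  "num_minimal_codewords G = card {c. minimal_codeword (graph_code G) c}"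

end

theory Submission
  imports Defs
begin

text \<open>Codewords of \<open>C(G)\<close> correspond to sets \<open>S\<close> of vertices: the sum of the rows indexed by \<open>S\<close>
  is the indicator of \<open>S\<close> on the left half and, on the right half, the indicator of the set
  \<open>odd_nbrs G S\<close> of vertices with an odd number of neighbours in \<open>S\<close>. Hence the codeword of
  \<open>S \<noteq> {}\<close> is minimal iff no nonempty proper subset \<open>T\<close> of \<open>S\<close> satisfies
  \<open>odd_nbrs G T \<subseteq> odd_nbrs G S\<close>.

  In the complete bipartite graph with classes \<open>A\<close> and \<open>B\<close>, the set \<open>odd_nbrs G S\<close> contains \<open>B\<close>
  or misses it according to the parity of \<open>card (S \<inter> A)\<close>, and contains \<open>A\<close> or misses it
  according to the parity of \<open>card (S \<inter> B)\<close>. A pair \<open>T\<close> inside one class has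
  \<open>odd_nbrs G T = {}\<close>, so a minimal \<open>S\<close> that contains such a pair equals it; and if \<open>S\<close> has
  exactly one vertex in each class, then either of them alone gives a smaller support. This leaves
  singletons and pairs inside one class, and these are minimal: a vertex of a pair has the whole
  opposite class as its odd neighbourhood, whereas that of the pair is empty. Counting the
  1-subsets and 2-subsets of the two classes gives the formula.\<close>

section \<open>Codewords as vertex sets\<close>

text \<open>The vertices with an odd number of neighbours in \<open>S\<close>. A neighbour of \<open>v\<close> is encoded as the
  tail \<open>u\<close> of an arc \<open>(u, v)\<close>, which follows column \<open>v\<close> of the adjacency matrix, so that the
  correspondence with codewords needs no symmetry of \<open>G\<close>.\<close>

definition odd_nbrs :: "'v pair_pre_digraph \<Rightarrow> 'v set \<Rightarrow> 'v set" where
  "odd_nbrs G S = {v \<in> pverts G. odd (card {u \<in> S. (u, v) \<in> parcs G})}"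

text \<open>The sum of the rows of \<open>[I | A]\<close> indexed by the vertices in \<open>S\<close>; both halves of the vector
  follow the vertices in increasing order.\<close>

definition codeword_of :: "'v::linorder pair_pre_digraph \<Rightarrow> 'v set \<Rightarrow> bit vec" where
  "codeword_of G S =
    (let n = card (pverts G); vs = sorted_list_of_set (pverts G)
     in vec (2 * n) (\<lambda>i. if i < n then of_bool (vs ! i \<in> S)
                         else of_bool (vs ! (i - n) \<in> odd_nbrs G S)))"

lemma of_nat_bit_eq_of_bool_odd: "(of_nat k :: bit) = of_bool (odd k)"
  by (induction k) auto

lemma bij_betw_nth_sorted_list_of_set:
  assumes "finite V"
  shows "bij_betw ((!) (sorted_list_of_set V)) {..<card V} V"
  using assms by (intro bij_betw_nth) auto

lemma nth_sorted_list_of_set_in: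
  assumes "finite V" "i < card V"
  shows "sorted_list_of_set V ! i \<in> V"
  using bij_betw_nth_sorted_list_of_set[OF assms(1)] assms(2) by (auto simp: bij_betw_def)

lemma codeword_of_in_carrier [simp]: "codeword_of G S \<in> carrier_vec (2 * card (pverts G))"
  by (simp add: codeword_of_def Let_def)

lemma generator_matrix_in_carrier:
  "generator_matrix G \<in> carrier_mat (card (pverts G)) (2 * card (pverts G))"
  by (auto simp: generator_matrix_def adjacency_matrix_def Let_def)

lemma transpose_generator_matrix_mult_indicator:
  fixes G :: "'v::linorder pair_pre_digraph"
  assumes fin: "finite (pverts G)" and S: "S \<subseteq> pverts G"
  defines "n \<equiv> card (pverts G)"
  defines "vs \<equiv> sorted_list_of_set (pverts G)"
  shows "(generator_matrix G)\<^sup>T *\<^sub>v vec n (\<lambda>i. of_bool (vs ! i \<in> S)) = codeword_of G S"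
    (is "?M\<^sup>T *\<^sub>v ?y = _")
proof (rule eq_vecI)
  have M: "?M \<in> carrier_mat n (2 * n)"
    using generator_matrix_in_carrier[of G] by (simp add: n_def)
  show "dim_vec (?M\<^sup>T *\<^sub>v ?y) = dim_vec (codeword_of G S)"
    using M by (simp add: codeword_of_def Let_def n_def)
  fix j assume "j < dim_vec (codeword_of G S)"
  then have j: "j < 2 * n" by (simp add: codeword_of_def Let_def n_def)
  have entry: "(?M\<^sup>T *\<^sub>v ?y) $ j = (\<Sum>i<n. ?M $$ (i, j) * of_bool (vs ! i \<in> S))"
    using M j by (simp add: scalar_prod_def atLeast0LessThan)
  show "(?M\<^sup>T *\<^sub>v ?y) $ j = codeword_of G S $ j"
  proof (cases "j < n")
    case True
    have "(\<Sum>i<n. ?M $$ (i, j) * of_bool (vs ! i \<in> S))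
        = (\<Sum>i<n. if i = j then of_bool (vs ! i \<in> S) else 0)"
      using True by (intro sum.cong)
        (auto simp: generator_matrix_def adjacency_matrix_def Let_def n_def)
    then show ?thesis
      using entry True j by (simp add: codeword_of_def Let_def n_def vs_def)
  next
    case False
    define v where "v = vs ! (j - n)"
    have v: "v \<in> pverts G"
      using nth_sorted_list_of_set_in[OF fin, of "j - n"] j False by (simp add: v_def vs_def n_def)
    have "(\<Sum>i<n. ?M $$ (i, j) * of_bool (vs ! i \<in> S))
        = (\<Sum>i<n. of_bool ((vs ! i, v) \<in> parcs G \<and> vs ! i \<in> S))"
      using False j by (intro sum.cong)
        (auto simp: generator_matrix_def adjacency_matrix_def Let_def n_def vs_def v_def)
    also have "\<dots> = (\<Sum>u\<in>pverts G. of_bool ((u, v) \<in> parcs G \<and> u \<in> S))"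
      unfolding n_def vs_def
      by (rule sum.reindex_bij_betw[OF bij_betw_nth_sorted_list_of_set[OF fin]])
    also have "\<dots> = of_nat (card {u \<in> pverts G. (u, v) \<in> parcs G \<and> u \<in> S})"
      using fin by (simp add: sum.inter_filter[symmetric] of_bool_def)
    also have "{u \<in> pverts G. (u, v) \<in> parcs G \<and> u \<in> S} = {u \<in> S. (u, v) \<in> parcs G}"
      using S by auto
    finally show ?thesis
      using entry False j v
      by (simp add: codeword_of_def Let_def n_def vs_def v_def odd_nbrs_def
          of_nat_bit_eq_of_bool_odd)
  qed
qed

lemma graph_code_eq_codeword_of_image:
  assumes fin: "finite (pverts G)"
  shows "graph_code G = codeword_of G ` Pow (pverts G)"
proof -
  define n where "n = card (pverts G)"
  define vs where "vs = sorted_list_of_set (pverts G)"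
  let ?M = "generator_matrix G"
  have M: "?M \<in> carrier_mat n (2 * n)"
    using generator_matrix_in_carrier[of G] by (simp add: n_def)
  have bij: "bij_betw ((!) vs) {..<n} (pverts G)"
    using bij_betw_nth_sorted_list_of_set[OF fin] by (simp add: n_def vs_def)
  have code: "graph_code G = {w \<in> carrier_vec (2 * n). \<exists>y\<in>carrier_vec n. ?M\<^sup>T *\<^sub>v y = w}"
    using vec_space.row_space_eq[OF M] M by (simp add: graph_code_def n_def)
  have mult: "?M\<^sup>T *\<^sub>v vec n (\<lambda>i. of_bool (vs ! i \<in> S)) = codeword_of G S"
    if "S \<subseteq> pverts G" for S
    using transpose_generator_matrix_mult_indicator[OF fin that] by (simp add: n_def vs_def)
  show ?thesis
  proof
    show "graph_code G \<subseteq> codeword_of G ` Pow (pverts G)"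
    proof
      fix w assume "w \<in> graph_code G"
      then obtain y where y: "y \<in> carrier_vec n" "?M\<^sup>T *\<^sub>v y = w"
        by (auto simp: code)
      define S where "S = (!) vs ` {i. i < n \<and> y $ i = 1}"
      have S: "S \<subseteq> pverts G"
        using bij by (auto simp: S_def bij_betw_def)
      have "vs ! i \<in> S \<longleftrightarrow> y $ i = 1" if "i < n" for i
        using bij that by (auto simp: S_def bij_betw_def inj_on_def)
      then have "y = vec n (\<lambda>i. of_bool (vs ! i \<in> S))"
        using y(1) by (intro eq_vecI) (auto simp: of_bool_def)
      then have "w = codeword_of G S"
        using mult[OF S] y(2) by argo
      then show "w \<in> codeword_of G ` Pow (pverts G)"
        using S by auto
    qed
    show "codeword_of G ` Pow (pverts G) \<subseteq> graph_code G"
    proof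
      fix w assume "w \<in> codeword_of G ` Pow (pverts G)"
      then obtain S where S: "S \<subseteq> pverts G" "w = codeword_of G S" by auto
      then show "w \<in> graph_code G"
        unfolding code using mult[OF S(1)] codeword_of_in_carrier[of G S]
        by (auto simp: n_def intro!: bexI[of _ "vec n (\<lambda>i. of_bool (vs ! i \<in> S))"])
    qed
  qed
qed

lemma supp_vec_codeword_of_subset_iff:
  assumes fin: "finite (pverts G)" and S: "S \<subseteq> pverts G" and T: "T \<subseteq> pverts G"
  shows "supp_vec (codeword_of G T) \<subseteq> supp_vec (codeword_of G S)
    \<longleftrightarrow> T \<subseteq> S \<and> odd_nbrs G T \<subseteq> odd_nbrs G S"
proof -
  define n where "n = card (pverts G)"
  define vs where "vs = sorted_list_of_set (pverts G)"
  have image: "(!) vs ` {..<n} = pverts G"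
    using bij_betw_nth_sorted_list_of_set[OF fin] by (simp add: n_def vs_def bij_betw_def)
  have transfer: "(\<forall>i<n. vs ! i \<in> X \<longrightarrow> vs ! i \<in> Y) \<longleftrightarrow> X \<subseteq> Y" if "X \<subseteq> pverts G" for X Y
    using that unfolding image[symmetric] by auto
  have supp: "i \<in> supp_vec (codeword_of G X) \<longleftrightarrow>
      i < n \<and> vs ! i \<in> X \<or> n \<le> i \<and> i < 2 * n \<and> vs ! (i - n) \<in> odd_nbrs G X" for X i
    by (auto simp: supp_vec_def codeword_of_def Let_def n_def vs_def split: if_splits)
  have "supp_vec (codeword_of G T) \<subseteq> supp_vec (codeword_of G S) \<longleftrightarrow>
      (\<forall>i<n. vs ! i \<in> T \<longrightarrow> vs ! i \<in> S) \<and>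
      (\<forall>i<n. vs ! i \<in> odd_nbrs G T \<longrightarrow> vs ! i \<in> odd_nbrs G S)" (is "?l \<longleftrightarrow> ?r")
  proof
    assume l: ?l
    have "vs ! i \<in> odd_nbrs G S" if "i < n" "vs ! i \<in> odd_nbrs G T" for i
      using subsetD[OF l, of "n + i"] that by (auto simp: supp)
    moreover have "vs ! i \<in> S" if "i < n" "vs ! i \<in> T" for i
      using subsetD[OF l, of i] that by (auto simp: supp)
    ultimately show ?r by blast
  next
    assume r: ?r
    show ?l
    proof
      fix i assume "i \<in> supp_vec (codeword_of G T)"
      with r show "i \<in> supp_vec (codeword_of G S)"
        unfolding supp by (auto dest: spec[of _ "i - n"])
    qed
  qed
  moreover have "odd_nbrs G T \<subseteq> pverts G" by (auto simp: odd_nbrs_def)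
  ultimately show ?thesis using transfer T by simp
qed

lemma inj_on_codeword_of:
  assumes "finite (pverts G)"
  shows "inj_on (codeword_of G) (Pow (pverts G))"
proof (rule inj_onI)
  fix S T assume "S \<in> Pow (pverts G)" "T \<in> Pow (pverts G)" "codeword_of G S = codeword_of G T"
  then show "S = T"
    using supp_vec_codeword_of_subset_iff[OF assms, of S T]
      supp_vec_codeword_of_subset_iff[OF assms, of T S] by auto
qed

lemma codeword_of_empty: "codeword_of G {} = 0\<^sub>v (2 * card (pverts G))"
  by (intro eq_vecI) (auto simp: codeword_of_def Let_def odd_nbrs_def)

lemma codeword_of_eq_zero_iff:
  assumes "finite (pverts G)" "S \<subseteq> pverts G"
  shows "codeword_of G S = 0\<^sub>v (dim_vec (codeword_of G S)) \<longleftrightarrow> S = {}"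
proof -
  have "codeword_of G S = 0\<^sub>v (dim_vec (codeword_of G S)) \<longleftrightarrow> codeword_of G S = codeword_of G {}"
    by (simp only: carrier_vecD[OF codeword_of_in_carrier] codeword_of_empty)
  also have "\<dots> \<longleftrightarrow> S = {}"
    using inj_on_codeword_of[OF assms(1)] assms(2) by (auto simp: inj_on_def)
  finally show ?thesis .
qed

text \<open>A vertex set whose codeword is minimal. The inclusion of right halves may be an equality:
  the left halves already make the inclusion of supports strict.\<close>

definition minimal_vertex_set :: "'v pair_pre_digraph \<Rightarrow> 'v set \<Rightarrow> bool" where
  "minimal_vertex_set G S \<longleftrightarrow> S \<subseteq> pverts G \<and> S \<noteq> {} \<and>
     (\<forall>T. T \<noteq> {} \<and> T \<subset> S \<longrightarrow> \<not> odd_nbrs G T \<subseteq> odd_nbrs G S)"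

lemma minimal_codeword_codeword_of_iff:
  assumes fin: "finite (pverts G)" and S: "S \<subseteq> pverts G"
  shows "minimal_codeword (graph_code G) (codeword_of G S) \<longleftrightarrow> minimal_vertex_set G S"
proof -
  have strict: "supp_vec (codeword_of G T) \<subset> supp_vec (codeword_of G S)
      \<longleftrightarrow> T \<subset> S \<and> odd_nbrs G T \<subseteq> odd_nbrs G S" if "T \<subseteq> pverts G" for T
    using supp_vec_codeword_of_subset_iff[OF fin S that]
      supp_vec_codeword_of_subset_iff[OF fin that S] by auto
  have code: "graph_code G = codeword_of G ` Pow (pverts G)"
    by (rule graph_code_eq_codeword_of_image[OF fin])
  have "(\<exists>c\<in>graph_code G. c \<noteq> 0\<^sub>v (dim_vec c) \<and> supp_vec c \<subset> supp_vec (codeword_of G S)) \<longleftrightarrow>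
      (\<exists>T\<in>Pow (pverts G). codeword_of G T \<noteq> 0\<^sub>v (dim_vec (codeword_of G T)) \<and>
          supp_vec (codeword_of G T) \<subset> supp_vec (codeword_of G S))"
    unfolding code by (rule bex_simps)
  also have "\<dots> \<longleftrightarrow>
      (\<exists>T\<in>Pow (pverts G). T \<noteq> {} \<and> T \<subset> S \<and> odd_nbrs G T \<subseteq> odd_nbrs G S)"
    by (rule bex_cong[OF refl]) (simp only: Pow_iff codeword_of_eq_zero_iff[OF fin] strict)
  also have "\<dots> \<longleftrightarrow> (\<exists>T. T \<noteq> {} \<and> T \<subset> S \<and> odd_nbrs G T \<subseteq> odd_nbrs G S)"
    using S by blast
  finally have smaller: "(\<exists>c\<in>graph_code G. c \<noteq> 0\<^sub>v (dim_vec c) \<and>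
        supp_vec c \<subset> supp_vec (codeword_of G S)) \<longleftrightarrow>
      (\<exists>T. T \<noteq> {} \<and> T \<subset> S \<and> odd_nbrs G T \<subseteq> odd_nbrs G S)" .
  have "codeword_of G S \<in> graph_code G"
    using S unfolding code by (intro imageI PowI)
  then show ?thesis
    unfolding minimal_codeword_def smaller codeword_of_eq_zero_iff[OF fin S] minimal_vertex_set_def
    using S by metis
qed

lemma num_minimal_codewords_eq_card_minimal_vertex_set:
  assumes fin: "finite (pverts G)"
  shows "num_minimal_codewords G = card {S. minimal_vertex_set G S}"
proof -
  have "{c. minimal_codeword (graph_code G) c} = codeword_of G ` {S. minimal_vertex_set G S}"
    (is "?l = ?r")
  proof
    show "?l \<subseteq> ?r"
    proof
      fix c assume c: "c \<in> ?l"
      then have "c \<in> codeword_of G ` Pow (pverts G)"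
        by (simp add: minimal_codeword_def graph_code_eq_codeword_of_image[OF fin])
      with c show "c \<in> ?r"
        using minimal_codeword_codeword_of_iff[OF fin] by auto
    qed
    show "?r \<subseteq> ?l"
      using minimal_codeword_codeword_of_iff[OF fin] by (auto simp: minimal_vertex_set_def)
  qed
  moreover have "inj_on (codeword_of G) {S. minimal_vertex_set G S}"
    by (rule inj_on_subset[OF inj_on_codeword_of[OF fin]]) (auto simp: minimal_vertex_set_def)
  ultimately show ?thesis
    by (simp add: num_minimal_codewords_def card_image)
qed

section \<open>Minimal vertex sets of a complete bipartite graph\<close>

lemma odd_nbrs_bipartite:
  assumes V: "pverts G = A \<union> B" and E: "parcs G = A \<times> B \<union> B \<times> A" and disj: "A \<inter> B = {}"
  shows "odd_nbrs G S = (if odd (card (S \<inter> A)) then B else {}) \<union>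
                        (if odd (card (S \<inter> B)) then A else {})"
proof (rule Set.set_eqI)
  fix v
  consider "v \<in> A" "v \<notin> B" | "v \<in> B" "v \<notin> A" | "v \<notin> A \<union> B" using disj by blast
  then show "v \<in> odd_nbrs G S \<longleftrightarrow>
      v \<in> (if odd (card (S \<inter> A)) then B else {}) \<union> (if odd (card (S \<inter> B)) then A else {})"
  proof cases
    case 1
    then have "{u \<in> S. (u, v) \<in> parcs G} = S \<inter> B" unfolding E by blast
    with 1 show ?thesis by (simp add: odd_nbrs_def V)
  next
    case 2
    then have "{u \<in> S. (u, v) \<in> parcs G} = S \<inter> A" unfolding E by blast
    with 2 show ?thesis by (simp add: odd_nbrs_def V)
  next
    case 3
    then show ?thesis by (simp add: odd_nbrs_def V)
  qed
qed

text \<open>The two classes play symmetric roles in the hypotheses, so the next two lemmas also apply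
  with \<open>A\<close> and \<open>B\<close> exchanged.\<close>

lemma minimal_vertex_set_bipartiteI:
  assumes V: "pverts G = A \<union> B" and E: "parcs G = A \<times> B \<union> B \<times> A" and disj: "A \<inter> B = {}"
    and "B \<noteq> {}" and S: "S \<subseteq> A" and card: "card S = 1 \<or> card S = 2"
  shows "minimal_vertex_set G S"
  unfolding minimal_vertex_set_def
proof (intro conjI allI impI notI)
  show "S \<subseteq> pverts G" using S V by auto
  show False if "S = {}" using that card by simp
  fix T assume T: "T \<noteq> {} \<and> T \<subset> S" and le: "odd_nbrs G T \<subseteq> odd_nbrs G S"
  have finS: "finite S" using card by (auto intro: card_ge_0_finite)
  moreover have "finite T"
    using finS T by (meson finite_subset psubset_imp_subset)
  ultimately have "card T < card S" "card T \<noteq> 0"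
    using T by (simp_all add: psubset_card_mono)
  then have "card T = 1" "card S = 2" using card by auto
  moreover have "T \<inter> A = T" "S \<inter> A = S" "S \<inter> B = {}" using T S disj by auto
  ultimately have "B \<subseteq> odd_nbrs G T" "odd_nbrs G S = {}"
    by (simp_all add: odd_nbrs_bipartite[OF V E disj])
  then show False using le \<open>B \<noteq> {}\<close> by auto
qed

lemma minimal_vertex_set_bipartite_two_le_card:
  assumes V: "pverts G = A \<union> B" and E: "parcs G = A \<times> B \<union> B \<times> A" and disj: "A \<inter> B = {}"
    and S: "minimal_vertex_set G S" and card: "2 \<le> card (S \<inter> A)"
  shows "S \<subseteq> A \<and> card S = 2"
proof -
  obtain T where T: "T \<subseteq> S \<inter> A" "card T = 2"
    by (rule obtain_subset_with_card_n[OF card])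
  then have "T \<inter> A = T" "T \<inter> B = {}" using disj by blast+
  then have "odd_nbrs G T = {}"
    using T(2) by (simp add: odd_nbrs_bipartite[OF V E disj])
  moreover have "T \<noteq> {}" using T(2) by auto
  ultimately have "\<not> T \<subset> S"
    using S unfolding minimal_vertex_set_def by (metis empty_subsetI)
  then have "T = S" using T(1) by blast
  then show ?thesis using T by blast
qed

lemma minimal_vertex_set_bipartite_iff:
  assumes V: "pverts G = A \<union> B" and E: "parcs G = A \<times> B \<union> B \<times> A" and disj: "A \<inter> B = {}"
    and fin: "finite A" "finite B" and ne: "A \<noteq> {}" "B \<noteq> {}"
  shows "minimal_vertex_set G S \<longleftrightarrow> (S \<subseteq> A \<or> S \<subseteq> B) \<and> (card S = 1 \<or> card S = 2)"
proof
  have V': "pverts G = B \<union> A" and E': "parcs G = B \<times> A \<union> A \<times> B" and disj': "B \<inter> A = {}"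
    using V E disj by auto
  {
    assume "(S \<subseteq> A \<or> S \<subseteq> B) \<and> (card S = 1 \<or> card S = 2)"
    then show "minimal_vertex_set G S"
      using minimal_vertex_set_bipartiteI[OF V E disj ne(2)]
        minimal_vertex_set_bipartiteI[OF V' E' disj' ne(1)] by blast
  }
  assume min: "minimal_vertex_set G S"
  then have sub: "S \<subseteq> A \<union> B" "S \<noteq> {}" by (auto simp: minimal_vertex_set_def V)
  then have finS: "finite S" using fin finite_subset by blast
  consider "2 \<le> card (S \<inter> A)" | "2 \<le> card (S \<inter> B)" | "S \<inter> A = {}" "card (S \<inter> B) < 2"
    | "S \<inter> B = {}" "card (S \<inter> A) < 2"
    | "card (S \<inter> A) = 1" "card (S \<inter> B) = 1"
  proof -
    have "card (S \<inter> A) = 0 \<longleftrightarrow> S \<inter> A = {}" "card (S \<inter> B) = 0 \<longleftrightarrow> S \<inter> B = {}"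
      using finS by auto
    then show thesis using that by linarith
  qed
  then show "(S \<subseteq> A \<or> S \<subseteq> B) \<and> (card S = 1 \<or> card S = 2)"
  proof cases
    case 1
    then show ?thesis using minimal_vertex_set_bipartite_two_le_card[OF V E disj min] by blast
  next
    case 2
    then show ?thesis using minimal_vertex_set_bipartite_two_le_card[OF V' E' disj' min] by blast
  next
    case 3
    then have "S \<subseteq> B" "S \<inter> B = S" using sub by auto
    moreover have "card S \<noteq> 0" using finS sub by simp
    ultimately show ?thesis using 3 by auto
  next
    case 4
    then have "S \<subseteq> A" "S \<inter> A = S" using sub by auto
    moreover have "card S \<noteq> 0" using finS sub by simp
    ultimately show ?thesis using 4 by auto
  next
    \<comment> \<open>One vertex in each class: the vertex in \<open>A\<close> alone has a smaller support.\<close>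
    case 5
    define T where "T = S \<inter> A"
    have "T \<inter> A = T" "T \<inter> B = {}" using disj by (auto simp: T_def)
    then have "odd_nbrs G T \<subseteq> odd_nbrs G S"
      using 5 by (simp add: odd_nbrs_bipartite[OF V E disj] T_def)
    moreover have "T \<noteq> {}" "S \<inter> B \<noteq> {}" using 5 by (auto simp: T_def)
    moreover from this have "T \<subset> S" using disj unfolding T_def by blast
    ultimately have False using min unfolding minimal_vertex_set_def by metis
    then show ?thesis ..
  qed
qed

lemma card_one_or_two_subsets:
  assumes "finite A"
  shows "card {S. S \<subseteq> A \<and> (card S = 1 \<or> card S = 2)} = card A + (card A choose 2)"
proof -
  have "{S. S \<subseteq> A \<and> (card S = 1 \<or> card S = 2)}
      = {S. S \<subseteq> A \<and> card S = 1} \<union> {S. S \<subseteq> A \<and> card S = 2}" by auto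
  moreover have "card ({S. S \<subseteq> A \<and> card S = 1} \<union> {S. S \<subseteq> A \<and> card S = 2})
      = card {S. S \<subseteq> A \<and> card S = 1} + card {S. S \<subseteq> A \<and> card S = 2}"
    using assms by (intro card_Un_disjoint) auto
  ultimately show ?thesis
    using n_subsets[OF assms, of 1] n_subsets[OF assms, of 2] by simp
qed

theorem proposition3p2:
  fixes a b :: nat
  assumes "a \<ge> 1" and "b \<ge> 1"
  shows "num_minimal_codewords (complete_bipartite a b) = a + b + (a choose 2) + (b choose 2)"
proof -
  let ?G = "complete_bipartite a b"
  let ?A = "{1..a}"
  let ?B = "{a+1..a+b}"
  let ?F = "\<lambda>X. {S. S \<subseteq> X \<and> (card S = 1 \<or> card S = 2)}"
  have V: "pverts ?G = ?A \<union> ?B" and E: "parcs ?G = ?A \<times> ?B \<union> ?B \<times> ?A"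
    by (simp_all add: complete_bipartite_def)
  have disj: "?A \<inter> ?B = {}" by auto
  have "minimal_vertex_set ?G S \<longleftrightarrow> (S \<subseteq> ?A \<or> S \<subseteq> ?B) \<and> (card S = 1 \<or> card S = 2)" for S
    using minimal_vertex_set_bipartite_iff[OF V E disj] assms by auto
  then have "{S. minimal_vertex_set ?G S} = ?F ?A \<union> ?F ?B" by auto
  moreover have "?F ?A \<inter> ?F ?B = {}"
  proof (rule equals0I)
    fix S assume S: "S \<in> ?F ?A \<inter> ?F ?B"
    then have "S = {}" using disj by blast
    with S show False by simp
  qed
  then have "card (?F ?A \<union> ?F ?B) = card (?F ?A) + card (?F ?B)"
    by (intro card_Un_disjoint) simp_all
  moreover have "num_minimal_codewords ?G = card {S. minimal_vertex_set ?G S}"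
    by (rule num_minimal_codewords_eq_card_minimal_vertex_set) (simp add: V)
  ultimately show ?thesis
    using card_one_or_two_subsets[of ?A] card_one_or_two_subsets[of ?B] by simp
qed

end
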